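(* Let $s:[1,\infty)\to\mathbb{R}$ be a function with $s\in L_{\rm loc}[1,\infty)$ that is slowly decreasing with respect to summability $(L,1)$. If $s$ is summable $(L,1)$ to some $A\in\mathbb{R}$, then the ordinary limit $\lim_{t\to\infty}s(t)=A$ also exists.
   Context: $L_{\rm loc}[1,\infty)$ denotes the set of functions on $[1,\infty)$ that are Lebesgue integrable on every bounded interval $[1,t]$, $t>1$. A function $s\in L_{\rm loc}[1,\infty)$ is called summable $(L,1)$ to $A$ if $\lim_{t\to\infty}\tau(t)=A$, where $\tau(t):=\frac{1}{\log t}\int_1^t\frac{s(u)}{u}\,du$ for $t>1$, with $\log$ the natural logarithm. A function $s:[1,\infty)\to\mathbb{R}$ is called slowly decreasing with respect to summability $(L,1)$ if for every $\varepsilon>0$ there exist $t_0=t_0(\varepsilon)>1$ and $\lambda=\lambda(\varepsilon)>1$ such that $s(u)-s(t)\ge-\varepsilon$ whenever $t_0\le t<u\le t^\lambda$. *)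

theory Defs
  imports "HOL-Analysis.Analysis"
begin

(* A function on [1,\<infinity>) is a total function on the reals of which only the values on
   {1..} matter. Integrability is with respect to the completed measure lebesgue, so that
   Lebesgue measurable functions which are not Borel measurable are included. *)

definition L_loc :: "(real \<Rightarrow> real) set" where
  "L_loc = {s. \<forall>t>1. set_integrable lebesgue {1..t} s}"

definition log_mean :: "(real \<Rightarrow> real) \<Rightarrow> real \<Rightarrow> real" where
  "log_mean s t = 1 / ln t * (LINT u:{1..t}|lebesgue. s u / u)"

definition L1_summable_to :: "(real \<Rightarrow> real) \<Rightarrow> real \<Rightarrow> bool" where
  "L1_summable_to s A \<longleftrightarrow> (log_mean s \<longlongrightarrow> A) at_top"

definition L1_slowly_decreasing :: "(real \<Rightarrow> real) \<Rightarrow> bool" where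
  "L1_slowly_decreasing s \<longleftrightarrow>
     (\<forall>\<epsilon>>0. \<exists>t0>1. \<exists>l>1. \<forall>t u. t0 \<le> t \<and> t < u \<and> u \<le> t powr l \<longrightarrow> s u - s t \<ge> - \<epsilon>)"

end

theory Submission
  imports Defs
begin

text \<open>Comparing \<open>s\<close> with the value \<open>s t\<close> on the windows \<open>[t, t\<^sup>r]\<close> with \<open>r > 1\<close> and \<open>[t\<^sup>r, t]\<close> with
  \<open>r < 1\<close>, slow decrease bounds \<open>s t\<close> from above and from below, up to \<open>\<epsilon>\<close>, by the average of \<open>s\<close>
  over the window with respect to \<open>du / u\<close>. With \<open>\<tau>\<close> the logarithmic mean, either
  average equals \<open>(r \<tau>(t\<^sup>r) - \<tau>(t)) / (r - 1)\<close>, which tends to \<open>A\<close>.\<close>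

text \<open>On \<open>{1..b}\<close> the factor \<open>1 / u\<close> is at most 1, so
  \<open>s\<close> itself dominates. Absolute integrability allows the Lebesgue integral in
  \<open>log_mean\<close> to be traded for the gauge integral.\<close>

lemma L_loc_divide_absolutely_integrable:
  assumes "s \<in> L_loc" "1 < b"
  shows "(\<lambda>u. s u / u) absolutely_integrable_on {1..b}"
proof -
  have s: "integrable lebesgue (\<lambda>u. indicator {1..b} u *\<^sub>R s u)"
    using assms unfolding L_loc_def set_integrable_def by auto
  have "(\<lambda>u::real. u) \<in> borel_measurable lebesgue"
    by (intro measurable_completion) simp
  then have "(\<lambda>u. (indicator {1..b} u *\<^sub>R s u) / u) \<in> borel_measurable lebesgue"
    using borel_measurable_integrable[OF s] by (intro borel_measurable_divide)
  then have "(\<lambda>u. indicator {1..b} u *\<^sub>R (s u / u)) \<in> borel_measurable lebesgue"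
    by simp
  moreover have "norm (indicator {1..b} u *\<^sub>R (s u / u)) \<le> norm (indicator {1..b} u *\<^sub>R s u)" for u
    using mult_left_mono[of 1 u "\<bar>s u\<bar>"] by (auto simp: indicator_def divide_le_eq)
  ultimately show ?thesis
    unfolding set_integrable_def by (intro Bochner_Integration.integrable_bound[OF s]) auto
qed

text \<open>For \<open>t > 1\<close> the factor \<open>ln t\<close> is nonzero and cancels the
  normalisation of \<open>log_mean\<close>, leaving the integral over \<open>{1..t}\<close>; the
  integrals up to \<open>a\<close> and up to \<open>b\<close> are then subtracted.\<close>

lemma ln_mult_log_mean_diff:
  assumes "s \<in> L_loc" "1 < a" "a \<le> b"
  shows "((\<lambda>u. s u / u) has_integral ln b * log_mean s b - ln a * log_mean s a) {a..b}"
proof -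
  let ?f = "\<lambda>u. s u / u"
  have F: "ln t * log_mean s t = integral {1..t} ?f" if "1 < t" for t
    using that L_loc_divide_absolutely_integrable[OF assms(1) that]
    by (simp add: log_mean_def set_lebesgue_integral_eq_integral(2))
  have f: "?f integrable_on {1..b}"
    using L_loc_divide_absolutely_integrable[of s b] assms set_lebesgue_integral_eq_integral(1)
    by fastforce
  have "integral {1..a} ?f + integral {a..b} ?f = integral {1..b} ?f"
    using assms f by (intro Henstock_Kurzweil_Integration.integral_combine) auto
  moreover have "?f integrable_on {a..b}"
    using f by (rule integrable_on_subinterval) (use assms in auto)
  ultimately show ?thesis
    using assms F[of a] F[of b] by (simp add: has_integral_iff)
qed

lemma has_integral_const_divide:
  fixes a b c :: real
  assumes "0 < a" "a \<le> b"
  shows "((\<lambda>u. c / u) has_integral c * (ln b - ln a)) {a..b}"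
proof -
  have "((\<lambda>u. c / u) has_integral c * ln b - c * ln a) {a..b}"
    using assms
    by (intro fundamental_theorem_of_calculus)
       (auto intro!: derivative_eq_intros simp: has_real_derivative_iff_has_vector_derivative[symmetric])
  then show ?thesis
    by (simp add: right_diff_distrib)
qed

lemma log_mean_diff_ge:
  assumes "s \<in> L_loc" "1 < a" "a \<le> b" and "\<And>u. u \<in> {a..b} \<Longrightarrow> c \<le> s u"
  shows "c * (ln b - ln a) \<le> ln b * log_mean s b - ln a * log_mean s a"
  using assms
  by (intro has_integral_le[OF has_integral_const_divide[of a b c] ln_mult_log_mean_diff])
     (auto intro!: divide_right_mono)

lemma log_mean_diff_le:
  assumes "s \<in> L_loc" "1 < a" "a \<le> b" and "\<And>u. u \<in> {a..b} \<Longrightarrow> s u \<le> c"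
  shows "ln b * log_mean s b - ln a * log_mean s a \<le> c * (ln b - ln a)"
  using assms
  by (intro has_integral_le[OF ln_mult_log_mean_diff has_integral_const_divide[of a b c]])
     (auto intro!: divide_right_mono)

text \<open>Since \<open>ln (t powr r) = r * ln t\<close>, the quotient is the window average with
  \<open>ln t\<close> cancelled. For \<open>r < 1\<close> numerator and denominator both change
  sign, so one formula serves both windows.\<close>

lemma L1_summable_to_window_mean:
  assumes "L1_summable_to s A" "0 < r" "r \<noteq> 1"
  shows "((\<lambda>t. (r * log_mean s (t powr r) - log_mean s t) / (r - 1)) \<longlongrightarrow> A) at_top"
proof -
  have lim: "(log_mean s \<longlongrightarrow> A) at_top"
    using assms(1) by (simp add: L1_summable_to_def)
  have "((\<lambda>t. log_mean s (t powr r)) \<longlongrightarrow> A) at_top"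
    using assms(2) by (intro filterlim_compose[OF lim] real_powr_at_top)
  then have "((\<lambda>t. (r * log_mean s (t powr r) - log_mean s t) / (r - 1))
      \<longlongrightarrow> (r * A - A) / (r - 1)) at_top"
    using assms(3) by (intro tendsto_intros lim) auto
  moreover have "(r * A - A) / (r - 1) = A"
    using assms(3) by (simp add: field_simps)
  ultimately show ?thesis
    by simp
qed

theorem corollary1:
  fixes s :: "real \<Rightarrow> real" and A :: real
  assumes "s \<in> L_loc"
    and "L1_slowly_decreasing s"
    and "L1_summable_to s A"
  shows "(s \<longlongrightarrow> A) at_top"
proof (rule tendstoI)
  fix e :: real assume "e > 0"
  define M where "M r t = (r * log_mean s (t powr r) - log_mean s t) / (r - 1)" for r t
  from \<open>e > 0\<close> assms(2) obtain t0 l where "t0 > 1" "l > 1"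
    and slow: "\<And>t u. t0 \<le> t \<Longrightarrow> t < u \<Longrightarrow> u \<le> t powr l \<Longrightarrow> s u - s t \<ge> - (e / 2)"
    unfolding L1_slowly_decreasing_def by (metis half_gt_zero)
  \<comment> \<open>The windows are closed, so the case \<open>u = t\<close> is needed as
    well.\<close>
  have slow': "s t - e / 2 \<le> s u" if "t0 \<le> t" "t \<le> u" "u \<le> t powr l" for t u
    using slow[of t u] that \<open>e > 0\<close> by (cases "t = u") auto
  \<comment> \<open>With this exponent, every \<open>u\<close> in \<open>{t powr r..t}\<close>
    satisfies \<open>t \<le> u powr l\<close>, so slow decrease applies from \<open>u\<close> to
    \<open>t\<close>.\<close>
  define r where "r = 1 / l"
  have r: "0 < r" "r < 1" "r * l = 1"
    using \<open>l > 1\<close> by (auto simp: r_def)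
  have "\<forall>\<^sub>F t in at_top. dist (M l t) A < e / 2" "\<forall>\<^sub>F t in at_top. dist (M r t) A < e / 2"
    unfolding M_def using \<open>l > 1\<close> r \<open>e > 0\<close>
    by (intro tendstoD[OF L1_summable_to_window_mean[OF assms(3)]]; simp)+
  \<comment> \<open>The whole left window must lie beyond \<open>t0\<close>.\<close>
  moreover have "\<forall>\<^sub>F t in at_top. t0 \<le> t powr r"
    using real_powr_at_top[OF r(1)] by (simp add: filterlim_at_top)
  ultimately show "\<forall>\<^sub>F t in at_top. dist (s t) A < e"
    using eventually_ge_at_top[of t0]
  proof eventually_elim
    case (elim t)
    then have t: "1 < t" "0 < ln t"
      using \<open>t0 > 1\<close> by auto
    have "s t - e / 2 \<le> M l t"
    proof -
      have "t \<le> t powr l"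
        using powr_mono[of 1 l t] t \<open>l > 1\<close> by simp
      then have "(s t - e / 2) * (ln (t powr l) - ln t)
          \<le> ln (t powr l) * log_mean s (t powr l) - ln t * log_mean s t"
        using elim t slow'[of t] by (intro log_mean_diff_ge assms) auto
      then have "ln t * ((s t - e / 2) * (l - 1)) \<le> ln t * (l * log_mean s (t powr l) - log_mean s t)"
        using t by (simp add: ln_powr algebra_simps diff_divide_distrib)
      then show ?thesis
        using t \<open>l > 1\<close> by (simp add: M_def pos_le_divide_eq)
    qed
    moreover have "M r t \<le> s t + e / 2"
    proof -
      have "t powr r \<le> t"
        using powr_mono[of r 1 t] t r by simp
      moreover have "s u \<le> s t + e / 2" if "u \<in> {t powr r..t}" for u
      proof -
        have "(t powr r) powr l \<le> u powr l"
          using that \<open>l > 1\<close> by (intro powr_mono2) auto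
        then have "t \<le> u powr l"
          using t r by (simp add: powr_powr)
        then show ?thesis
          using slow'[of u t] that elim by auto
      qed
      ultimately have "ln t * log_mean s t - ln (t powr r) * log_mean s (t powr r)
          \<le> (s t + e / 2) * (ln t - ln (t powr r))"
        using elim \<open>t0 > 1\<close> by (intro log_mean_diff_le assms) auto
      \<comment> \<open>Both sides are negated here; dividing by \<open>r - 1 < 0\<close> afterwards
        turns the inequality round again.\<close>
      then have "ln t * ((s t + e / 2) * (r - 1)) \<le> ln t * (r * log_mean s (t powr r) - log_mean s t)"
        using t by (simp add: ln_powr algebra_simps diff_divide_distrib)
      then show ?thesis
        using t r by (simp add: M_def neg_divide_le_eq)
    qed
    \<comment> \<open>Both window means lie within \<open>e / 2\<close> of \<open>A\<close>, and
      each comparison with \<open>s t\<close> costs another \<open>e / 2\<close>.\<close>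
    ultimately show ?case
      using elim(1,2) unfolding dist_real_def abs_diff_less_iff by linarith
  qed
qed

end
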